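(* Let $A\in\mathbb{Z}_{\geqslant1}$ and let $\rho$ satisfy $\phi_{A,0}(\rho)=0$, where $\phi_{A,0}(z)=\operatorname{Li}_2(z)+4\pi^2A$. Then $$\rho=-\exp\bigl(\pi\sqrt{8A-1/3}\bigr)+O\bigl(1/\sqrt{A}\bigr).$$ Moreover, Newton's method applied to $\phi_{A,0}$ with initial value $c_0=-\exp\bigl(\pi\sqrt{8A-1/3}\bigr)$, i.e. the sequence $c_{n+1}=c_n-\phi_{A,0}(c_n)/\phi_{A,0}'(c_n)$, converges quadratically to $\rho$.
   Context: $\log$ is the principal logarithm ($-\pi<\arg z\leqslant\pi$). $\operatorname{Li}_2$ is the principal branch of the dilogarithm: $\operatorname{Li}_2(z)=\sum_{n\geqslant1}z^n/n^2$ for $|z|\leqslant1$, continued to $\mathbb{C}\setminus[1,\infty)$ by $-\int_0^z\log(1-u)\,du/u$, and on $[1,\infty)$ defined as the limit from the lower half plane. Its derivative on $\mathbb{C}\setminus[1,\infty)$ is $\operatorname{Li}_2'(z)=-\log(1-z)/z$, so $\phi_{A,0}'(z)=-\log(1-z)/z$. *)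

theory Defs
  imports "HOL-Complex_Analysis.Complex_Analysis"
begin

text \<open>
  The integral representation of the dilogarithm, meant for arguments off the cut
  \<open>[1, \<infinity>)\<close>. As the slit plane is star-shaped about the origin, the path of
  integration can be taken to be the segment from \<open>0\<close> to \<open>z\<close>; the singularity of the
  integrand at \<open>0\<close> is removable, and its value there does not affect the integral.
\<close>

definition Li2_int :: "complex \<Rightarrow> complex" where
  "Li2_int z = - contour_integral (linepath 0 z) (\<lambda>u. Ln (1 - u) / u)"

text \<open>
  The principal branch of the dilogarithm. At \<open>z = 1\<close>, which lies both on the unit circle
  and on the cut, the series is used; it agrees there with the limit from below because it
  is continuous on the closed unit disc.
\<close>

definition Li2 :: "complex \<Rightarrow> complex" where
  "Li2 z =
    (if norm z \<le> 1 then (\<Sum>n. z ^ Suc n / of_nat (Suc n) ^ 2)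
     else if z \<in> complex_of_real ` {1..} then Lim (at z within {w. Im w < 0}) Li2_int
     else Li2_int z)"

definition phi0 :: "int \<Rightarrow> complex \<Rightarrow> complex" where
  "phi0 A z = Li2 z + 4 * of_real pi ^ 2 * of_int A"

definition rho_approx :: "int \<Rightarrow> complex" where
  "rho_approx A = - of_real (exp (pi * sqrt (8 * of_int A - 1 / 3)))"

primrec newton_seq :: "(complex \<Rightarrow> complex) \<Rightarrow> complex \<Rightarrow> nat \<Rightarrow> complex" where
  "newton_seq f c 0 = c"
| "newton_seq f c (Suc n) =
     newton_seq f c n - f (newton_seq f c n) / deriv f (newton_seq f c n)"

text \<open>
  Both \<open>deriv\<close> and division are total in HOL, so the iterates above exist formally even where
  Newton's method breaks down; this predicate says that every step is a genuine one.
\<close>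

definition newton_well_defined :: "(complex \<Rightarrow> complex) \<Rightarrow> complex \<Rightarrow> bool" where
  "newton_well_defined f c \<longleftrightarrow>
    (\<forall>n. f field_differentiable at (newton_seq f c n) \<and> deriv f (newton_seq f c n) \<noteq> 0)"

definition converges_quadratically :: "(nat \<Rightarrow> complex) \<Rightarrow> complex \<Rightarrow> bool" where
  "converges_quadratically c l \<longleftrightarrow>
    c \<longlonglongrightarrow> l \<and> (\<exists>K. \<forall>n. norm (c (Suc n) - l) \<le> K * norm (c n - l) ^ 2)"

end

theory Submission
  imports Defs
begin

text \<open>
  The series bounds \<open>Li2\<close> on the unit disc, so a zero \<open>\<rho>\<close> lies outside it, where the inversion formula
  \<open>Li2 z = - \<pi>\<^sup>2/6 - Ln(-z)\<^sup>2/2 - Li2(1/z)\<close> applies. With \<open>w = Ln(-\<rho>)\<close> and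
  \<open>s = \<pi> sqrt (8A - 1/3)\<close> the equation becomes \<open>w\<^sup>2 = s\<^sup>2 - 2 Li2(1/\<rho>)\<close>. As \<open>Re w > 0\<close> and
  \<open>Li2(1/\<rho>) = O(1/\<bar>\<rho>\<bar>)\<close>, this gives \<open>\<bar>w - s\<bar> = O(1/(s \<bar>\<rho>\<bar>))\<close>, and exponentiating costs a factor
  \<open>\<bar>\<rho>\<bar>\<close>, so that \<open>\<bar>\<rho> + exp s\<bar> = O(1/s)\<close> with a bound below \<open>1\<close>. On the unit disc about \<open>\<rho>\<close> the second
  derivative of \<open>phi0 A\<close> is smaller than the first, so every Newton step there at least squares the
  distance to \<open>\<rho>\<close>.
\<close>

subsection \<open>The dilogarithm on the slit plane\<close>

definition slit_plane :: "complex set" where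
  "slit_plane = - (complex_of_real ` {1..})"

lemma slit_plane_iff: "z \<in> slit_plane \<longleftrightarrow> \<not> (1 \<le> Re z \<and> Im z = 0)"
  by (auto simp: slit_plane_def complex_slot_right_eq)

lemma open_slit_plane: "open slit_plane"
  unfolding slit_plane_def using closed_slot_right[of 1] by (simp add: open_Compl)

lemma one_minus_slit_plane: "z \<in> slit_plane \<Longrightarrow> 1 - z \<notin> \<real>\<^sub>\<le>\<^sub>0"
  by (auto simp: slit_plane_iff complex_nonpos_Reals_iff)

text \<open>The value -1 is the derivative of \<open>Ln (1 - u)\<close> at 0. It removes the
  singularity, where the default \<open>x / 0 = 0\<close> would leave a discontinuity.\<close>

definition Ln_quot :: "complex \<Rightarrow> complex" where
  "Ln_quot u = (if u = 0 then -1 else Ln (1 - u) / u)"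

lemma Ln_quot_tendsto_0: "(Ln_quot \<longlongrightarrow> -1) (at 0)"
proof -
  have "((\<lambda>u. Ln (1 - u)) has_field_derivative -1) (at 0)"
    by (auto intro!: derivative_eq_intros simp: complex_nonpos_Reals_iff)
  then have "((\<lambda>u. Ln (1 - u) / u) \<longlongrightarrow> -1) (at 0)"
    by (simp add: has_field_derivative_iff)
  then show ?thesis
    by (rule Lim_transform_eventually) (auto simp: Ln_quot_def eventually_at_filter)
qed

lemma Ln_quot_holomorphic: "Ln_quot holomorphic_on slit_plane"
proof (rule no_isolated_singularity'[where K = "{0}"])
  show "(Ln_quot \<longlongrightarrow> Ln_quot z) (at z within slit_plane)" if "z \<in> {0}" for z
    using Ln_quot_tendsto_0 that by (auto simp: Ln_quot_def intro: tendsto_within_subset)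
  have "(\<lambda>u. Ln (1 - u) / u) holomorphic_on slit_plane - {0}"
    by (intro holomorphic_intros) (auto dest: one_minus_slit_plane)
  then show "Ln_quot holomorphic_on slit_plane - {0}"
    by (rule holomorphic_transform) (simp add: Ln_quot_def)
qed (auto simp: open_slit_plane)

lemma closed_segment_slit_plane: "z \<in> slit_plane \<Longrightarrow> closed_segment 0 z \<subseteq> slit_plane"
  using starlike_slotted_complex_plane_right_aux[of z 1 0] by (simp add: slit_plane_def)

text \<open>A segment from 0 to \<open>z \<noteq> 0\<close> meets 0 only at parameter 0, a null set;
  for \<open>z = 0\<close> both integrands carry the factor \<open>z - 0 = 0\<close>.\<close>

lemma has_contour_integral_Ln_quot_iff:
  "((\<lambda>u. Ln (1 - u) / u) has_contour_integral i) (linepath 0 z) \<longleftrightarrow>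
   (Ln_quot has_contour_integral i) (linepath 0 z)"
  unfolding has_contour_integral_linepath
  by (rule has_integral_spike_eq[of "{0}"]) (auto simp: Ln_quot_def linepath_def)

lemma Li2_int_eq_primitive:
  assumes F: "\<And>x. x \<in> slit_plane \<Longrightarrow> (F has_field_derivative Ln_quot x) (at x)"
    and z: "z \<in> slit_plane"
  shows "Li2_int z = F 0 - F z"
proof -
  have "(Ln_quot has_contour_integral (F z - F 0)) (linepath 0 z)"
    using contour_integral_primitive[of slit_plane F Ln_quot "linepath 0 z"]
      closed_segment_slit_plane[OF z] F
    by (auto intro: has_field_derivative_at_within)
  then show ?thesis
    by (simp add: Li2_int_def contour_integral_unique has_contour_integral_Ln_quot_iff)
qed

text \<open>The slit plane is open and starlike, so \<open>Ln_quot\<close> has a primitive there,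
  and \<open>Li2_int\<close> is a constant minus that primitive.\<close>

lemma Li2_int_has_field_derivative_Ln_quot:
  assumes "z \<in> slit_plane"
  shows "(Li2_int has_field_derivative - Ln_quot z) (at z)"
proof -
  obtain F where F: "\<And>x. x \<in> slit_plane \<Longrightarrow> (F has_field_derivative Ln_quot x) (at x)"
    using holomorphic_starlike_primitive[of slit_plane Ln_quot "{}"] Ln_quot_holomorphic
      open_slit_plane starlike_slotted_complex_plane_right[of 1]
    by (metis Diff_empty finite.emptyI holomorphic_on_imp_continuous_on
        holomorphic_on_imp_differentiable_at slit_plane_def)
  have "((\<lambda>x. F 0 - F x) has_field_derivative - Ln_quot z) (at z)"
    using F[OF assms] by (auto intro!: derivative_eq_intros)
  then show ?thesis
    by (rule has_field_derivative_transform_within_open[OF _ open_slit_plane assms])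
      (simp add: Li2_int_eq_primitive[OF F])
qed

lemma Li2_int_has_field_derivative:
  assumes "z \<in> slit_plane" "z \<noteq> 0"
  shows "(Li2_int has_field_derivative - Ln (1 - z) / z) (at z)"
  using Li2_int_has_field_derivative_Ln_quot[OF assms(1)] assms(2) by (simp add: Ln_quot_def)

lemma Li2_int_0 [simp]: "Li2_int 0 = 0"
  by (simp add: Li2_int_def)

lemma isCont_Li2_int: "z \<in> slit_plane \<Longrightarrow> isCont Li2_int z"
  using Li2_int_has_field_derivative_Ln_quot DERIV_isCont by blast

section \<open>The power series on the closed unit disc\<close>

definition Li2_series :: "complex \<Rightarrow> complex" where
  "Li2_series z = (\<Sum>n. z ^ Suc n / of_nat (Suc n) ^ 2)"

lemma summable_inverse_squares_Suc: "summable (\<lambda>n. 1 / real (Suc n) ^ 2)"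
  using inverse_squares_sums by (simp add: sums_iff add.commute)

text \<open>The factor \<open>norm z\<close> is kept because the series is later taken at the
  reciprocal of a zero, where it supplies the decay 1/|\<rho>|.\<close>

lemma norm_Li2_term_le:
  fixes z :: complex
  assumes "norm z \<le> 1"
  shows "norm (z ^ Suc n / of_nat (Suc n) ^ 2) \<le> norm z * (1 / real (Suc n) ^ 2)"
proof -
  have "norm z * norm z ^ n \<le> norm z * 1"
    using assms by (intro mult_left_mono power_le_one) auto
  then show ?thesis
    by (simp add: norm_divide norm_mult norm_power divide_right_mono del: of_nat_Suc)
qed

lemma summable_Li2_series:
  fixes z :: complex
  assumes "norm z \<le> 1"
  shows "summable (\<lambda>n. z ^ Suc n / of_nat (Suc n) ^ 2)"
  by (rule summable_comparison_test'[of _ 0, OF _ norm_Li2_term_le[OF assms]])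
     (intro summable_mult summable_inverse_squares_Suc)

lemma norm_Li2_series_le:
  assumes "norm z \<le> 1"
  shows "norm (Li2_series z) \<le> norm z * (pi\<^sup>2 / 6)"
proof -
  have "(\<lambda>n. norm z * (1 / real (Suc n) ^ 2)) sums (norm z * (pi\<^sup>2 / 6))"
    using inverse_squares_sums by (intro sums_mult) (simp add: add.commute)
  from norm_suminf_le[OF norm_Li2_term_le[OF assms] sums_summable[OF this]] sums_unique[OF this]
  show ?thesis
    unfolding Li2_series_def by argo
qed

lemma Li2_series_has_field_derivative:
  assumes z: "norm z < 1"
  shows "(Li2_series has_field_derivative - Ln_quot z) (at z)"
proof -
  \<comment> \<open>Since \<open>1 / 0 = 0\<close>, the coefficient \<open>c 0\<close> vanishes and
    indexing from 0 leaves the sum unchanged.\<close>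
  define c :: "nat \<Rightarrow> complex" where "c = (\<lambda>n. 1 / of_nat n ^ 2)"
  have sm: "summable (\<lambda>n. c n * x ^ n)" if "norm x \<le> 1" for x
    using summable_Li2_series[OF that] by (subst summable_Suc_iff[symmetric]) (simp add: c_def)
  have eq: "(\<Sum>n. c n * x ^ n) = Li2_series x" if "norm x \<le> 1" for x
    using suminf_split_head[OF sm[OF that]] by (simp add: c_def Li2_series_def)
  have D: "((\<lambda>x. \<Sum>n. c n * x ^ n) has_field_derivative (\<Sum>n. diffs c n * z ^ n)) (at z)"
    using sm[of 1] z by (intro termdiffs_strong[of c 1]) auto
  have "(\<lambda>n. (-1)^Suc n / of_nat n * (-z)^n) sums Ln (1 - z)"
    using Ln_series[of "-z"] z by simp
  moreover have "(\<lambda>n. (-1)^Suc n / of_nat n * (-z)^n) = (\<lambda>n. - (z ^ n / of_nat n))"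
  proof
    fix n :: nat
    have "(-1::complex)^Suc n * (-z)^n = - (z ^ n)"
      by (metis (no_types, lifting) minus_one_mult_self mult.assoc mult_minus1 power_Suc power_minus)
    then show "(-1)^Suc n / of_nat n * (-z)^n = - (z ^ n / of_nat n)"
      by (simp add: field_simps)
  qed
  ultimately have "(\<lambda>n. - (z ^ n / of_nat n)) sums Ln (1 - z)"
    by simp
  then have L: "(\<lambda>n. z ^ n / of_nat n) sums - Ln (1 - z)"
    using sums_minus by fastforce
  have "(\<lambda>n. z ^ Suc n / of_nat (Suc n)) sums - Ln (1 - z)"
    using L by (subst sums_Suc_iff) simp
  have d: "diffs c n = 1 / of_nat (Suc n)" for n
    by (simp add: diffs_def c_def power2_eq_square del: of_nat_Suc)
  \<comment> \<open>Off 0 this is the logarithm series divided by \<open>z\<close>; at 0 only the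
    constant term 1 survives.\<close>
  have "(\<Sum>n. diffs c n * z ^ n) = - Ln_quot z"
  proof (cases "z = 0")
    case True
    have "(\<Sum>n. diffs c n * 0 ^ n) = diffs c 0"
      by (rule powser_zero)
    with True show ?thesis
      by (simp add: d Ln_quot_def)
  next
    case False
    have "(\<lambda>n. (z ^ Suc n / of_nat (Suc n)) / z) sums (- Ln (1 - z) / z)"
      by (intro sums_divide) fact
    then show ?thesis
      using False by (simp add: sums_iff d Ln_quot_def del: of_nat_Suc)
  qed
  with D have D': "((\<lambda>x. \<Sum>n. c n * x ^ n) has_field_derivative - Ln_quot z) (at z)"
    by simp
  show ?thesis
    by (rule has_field_derivative_transform_within_open[OF D', of "ball 0 1"])
       (use z in \<open>auto simp: eq\<close>)
qed

lemma unit_disc_slit_plane: "norm z < 1 \<Longrightarrow> z \<in> slit_plane"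
  using complex_Re_le_cmod[of z] by (auto simp: slit_plane_iff)

text \<open>Both sides have derivative \<open>- Ln_quot\<close> on the disc and vanish at 0.\<close>

lemma Li2_int_eq_series:
  assumes z: "norm z < 1"
  shows "Li2_int z = Li2_series z"
proof -
  have "\<exists>c. \<forall>x\<in>ball 0 1. Li2_int x - Li2_series x = c"
  proof (rule has_field_derivative_zero_constant)
    fix x :: complex
    assume "x \<in> ball 0 1"
    then have "norm x < 1" by simp
    then have "((\<lambda>x. Li2_int x - Li2_series x) has_field_derivative 0) (at x)"
      using DERIV_diff[OF Li2_int_has_field_derivative_Ln_quot Li2_series_has_field_derivative, of x]
        unit_disc_slit_plane by simp
    then show "((\<lambda>x. Li2_int x - Li2_series x) has_field_derivative 0) (at x within ball 0 1)"
      by (rule has_field_derivative_at_within)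
  qed auto
  then obtain c where c: "\<And>x. norm x < 1 \<Longrightarrow> Li2_int x - Li2_series x = c"
    by auto
  have "c = 0"
    using c[of 0] by (simp add: Li2_series_def)
  with c[OF z] show ?thesis by simp
qed

text \<open>The M-test with inverse squares reaches the boundary, which allows the value at -1 to be
  carried over to \<open>Li2_int\<close>.\<close>

lemma continuous_on_Li2_series: "continuous_on (cball 0 1) Li2_series"
proof -
  have "uniform_limit (cball 0 1) (\<lambda>n x. \<Sum>i<n. x ^ Suc i / of_nat (Suc i) ^ 2)
          (\<lambda>x. \<Sum>i. x ^ Suc i / of_nat (Suc i) ^ 2 :: complex) sequentially"
  proof (rule Weierstrass_m_test[OF _ summable_inverse_squares_Suc])
    fix n :: nat and x :: complex
    assume "x \<in> cball 0 1"
    then have x: "norm x \<le> 1" by simp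
    then have "norm x * (1 / real (Suc n) ^ 2) \<le> 1 * (1 / real (Suc n) ^ 2)"
      by (intro mult_right_mono) auto
    with norm_Li2_term_le[OF x, of n]
    show "norm (x ^ Suc n / of_nat (Suc n) ^ 2) \<le> 1 / real (Suc n) ^ 2"
      by linarith
  qed
  then have "continuous_on (cball 0 1) (\<lambda>x. \<Sum>i. x ^ Suc i / of_nat (Suc i) ^ 2 :: complex)"
    by (rule uniform_limit_theorem[rotated])
       (auto intro!: always_eventually continuous_intros simp del: of_nat_Suc)
  then show ?thesis
    by (simp add: Li2_series_def[abs_def])
qed

text \<open>The alternating sum is twice the sum over even denominators minus the full sum. The even
  part is a quarter of the full sum, which leaves (1/2 - 1) pi^2/6.\<close>

lemma Li2_series_minus_one: "Li2_series (-1) = - (of_real pi)\<^sup>2 / 12"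
proof -
  let ?a = "\<lambda>n. 1 / real (Suc n) ^ 2"
  have a: "?a sums (pi\<^sup>2 / 6)"
    using inverse_squares_sums by (simp add: add.commute)
  let ?b = "\<lambda>n. if even (Suc n) then 2 * ?a n else 0"
  \<comment> \<open>The denominator comes from \<open>Suc n\<close>, so the even ones sit at the odd
    indices.\<close>
  let ?g = "\<lambda>n. 2 * n + 1 :: nat"
  have "(\<lambda>n. ?b (?g n)) = (\<lambda>n. 1 / 2 * ?a n)"
  proof
    fix n
    have "Suc (?g n) = 2 * Suc n" by simp
    then have "?b (?g n) = 2 * (1 / real (2 * Suc n) ^ 2)" by presburger
    also have "\<dots> = 1 / 2 * ?a n"
      unfolding of_nat_mult power_mult_distrib by simp
    finally show "?b (?g n) = 1 / 2 * ?a n" .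
  qed
  then have "(\<lambda>n. ?b (?g n)) sums (1 / 2 * (pi\<^sup>2 / 6))"
    using sums_mult[OF a, of "1/2"] by simp
  moreover have "strict_mono ?g"
    by (auto simp: strict_mono_def)
  moreover have "?b n = 0" if "n \<notin> range ?g" for n
    using that by (metis oddE even_Suc rangeI)
  ultimately have "?b sums (1 / 2 * (pi\<^sup>2 / 6))"
    using sums_mono_reindex[of ?g ?b] by blast
  from sums_diff[OF this a] have "(\<lambda>n. ?b n - ?a n) sums (- (pi\<^sup>2 / 12))"
    by simp
  moreover have "(\<lambda>n. ?b n - ?a n) = (\<lambda>n. (-1) ^ Suc n / real (Suc n) ^ 2)"
    by (auto simp: field_simps)
  ultimately have "(\<lambda>n. (-1) ^ Suc n / real (Suc n) ^ 2) sums (- (pi\<^sup>2 / 12))"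
    by simp
  then have "(\<lambda>n. of_real ((-1) ^ Suc n / real (Suc n) ^ 2)) sums (of_real (- (pi\<^sup>2 / 12)) :: complex)"
    by (rule sums_of_real)
  then show ?thesis
    by (simp add: sums_iff Li2_series_def del: of_nat_Suc)
qed

text \<open>The point -1 is interior to the slit plane but on the boundary of the disc, so the two
  functions are compared through their limits from inside the disc.\<close>

lemma Li2_int_minus_one: "Li2_int (-1) = - (of_real pi)\<^sup>2 / 12"
proof -
  let ?F = "at (-1 :: complex) within ball 0 1"
  have nt: "?F \<noteq> bot"
    by (simp add: trivial_limit_within islimpt_ball)
  have "(Li2_int \<longlongrightarrow> Li2_int (-1)) ?F"
    using isCont_Li2_int[of "-1"] by (auto simp: isCont_def slit_plane_iff intro: tendsto_within_subset)
  moreover have "(Li2_series \<longlongrightarrow> Li2_series (-1)) ?F"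
    by (rule tendsto_within_subset[of _ _ _ "cball 0 1"])
       (use continuous_on_Li2_series in \<open>auto simp: continuous_on_def\<close>)
  moreover have "eventually (\<lambda>z. Li2_series z = Li2_int z) ?F"
    by (auto simp: eventually_at_filter Li2_int_eq_series)
  ultimately have "Li2_series (-1) = Li2_int (-1)"
    using tendsto_unique[OF nt] Lim_transform_eventually by blast
  then show ?thesis
    by (simp add: Li2_series_minus_one)
qed

subsection \<open>The inversion formula\<close>

lemma slotted_iff: "z \<in> - (complex_of_real ` {0..}) \<longleftrightarrow> \<not> (0 \<le> Re z \<and> Im z = 0)"
  by (auto simp: complex_slot_right_eq)

text \<open>\<open>(1 - inverse z) * (- z) = 1 - z\<close>, and the two factors have imaginary parts
  of opposite signs or are both positive reals. Their arguments thus add without leaving the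
  principal range.\<close>

lemma Ln_one_minus_inverse:
  assumes "z \<in> - (complex_of_real ` {0..})"
  shows "Ln (1 - z) = Ln (1 - inverse z) + Ln (- z)"
proof -
  have z: "\<not> (0 \<le> Re z \<and> Im z = 0)" "z \<noteq> 0"
    using assms unfolding slotted_iff by auto
  have nz: "1 - inverse z \<noteq> 0"
    using z by auto
  have sq: "(Re z)\<^sup>2 + (Im z)\<^sup>2 > 0"
    using z(2) by (simp add: complex_neq_0)
  have "- pi < Im (Ln (1 - inverse z)) + Im (Ln (- z)) \<and> Im (Ln (1 - inverse z)) + Im (Ln (- z)) \<le> pi"
  proof (cases "Im z" "0 :: real" rule: linorder_cases)
    case less
    then have "Im (1 - inverse z) < 0"
      using sq by (simp add: divide_neg_pos)
    then have "Im (Ln (1 - inverse z)) < 0" "- pi < Im (Ln (1 - inverse z))"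
      using Im_Ln_pos_le[OF nz] mpi_less_Im_Ln[OF nz] Im_Ln_le_pi[OF nz] by auto
    moreover have "0 < Im (Ln (- z))" "Im (Ln (- z)) < pi"
      using less Im_Ln_pos_lt_imp[of "- z"] by auto
    ultimately show ?thesis by linarith
  next
    case equal
    with z have "Re z < 0" by auto
    with equal have "Re (1 - inverse z) > 0" "Im (1 - inverse z) = 0"
      by (auto simp: divide_nonpos_pos add_pos_nonneg power2_eq_square divide_less_0_iff zero_less_mult_iff intro: less_trans[of _ 0])
    moreover have "Re (- z) > 0" "Im (- z) = 0"
      using equal \<open>Re z < 0\<close> by auto
    ultimately have "Im (Ln (1 - inverse z)) = 0" "Im (Ln (- z)) = 0"
      using Im_Ln_eq_0 nz z by (metis neg_equal_0_iff_equal)+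
    then show ?thesis by simp
  next
    case greater
    then have "Im (1 - inverse z) > 0"
      using sq by (simp add: divide_pos_pos)
    then have "0 < Im (Ln (1 - inverse z))" "Im (Ln (1 - inverse z)) < pi"
      using Im_Ln_pos_lt_imp by blast+
    moreover have "Im (Ln (- z)) < 0" "- pi < Im (Ln (- z))"
      using greater Im_Ln_pos_le[of "- z"] mpi_less_Im_Ln[of "- z"] Im_Ln_le_pi[of "- z"] z by auto
    ultimately show ?thesis by linarith
  qed
  then have "Ln ((1 - inverse z) * (- z)) = Ln (1 - inverse z) + Ln (- z)"
    using nz z by (intro Ln_times_simple) auto
  moreover have "(1 - inverse z) * (- z) = 1 - z"
    using z by (simp add: algebra_simps)
  ultimately show ?thesis by simp
qed

lemma slotted_slit_plane:
  assumes "z \<in> - (complex_of_real ` {0..})"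
  shows "z \<in> slit_plane" "inverse z \<in> slit_plane" "- z \<notin> \<real>\<^sub>\<le>\<^sub>0" "z \<noteq> 0"
proof -
  have z: "\<not> (0 \<le> Re z \<and> Im z = 0)"
    using assms unfolding slotted_iff by auto
  then show "z \<in> slit_plane" "- z \<notin> \<real>\<^sub>\<le>\<^sub>0" "z \<noteq> 0"
    by (auto simp: slit_plane_iff complex_nonpos_Reals_iff)
  show "inverse z \<in> slit_plane"
    using z by (auto simp: slit_plane_iff)
      (smt (verit) divide_nonpos_nonneg zero_le_power2)
qed

text \<open>By \<open>Ln_one_minus_inverse\<close> the sum of the non-constant terms has derivative
  0 on a connected set. The constant is read off at -1, a fixed point of inversion where
  \<open>Ln (- z) = 0\<close>.\<close>

lemma Li2_int_inversion:
  assumes "z \<in> - (complex_of_real ` {0..})"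
  shows "Li2_int z = - (of_real pi)\<^sup>2 / 6 - (Ln (- z))\<^sup>2 / 2 - Li2_int (inverse z)"
proof -
  let ?S = "- (complex_of_real ` {0..})"
  let ?D = "\<lambda>z. Li2_int z + Li2_int (inverse z) + (Ln (- z))\<^sup>2 / 2"
  have D: "(?D has_field_derivative 0) (at x)" if x: "x \<in> ?S" for x
  proof -
    note x' = slotted_slit_plane[OF x]
    have "(Li2_int has_field_derivative - Ln (1 - inverse x) / inverse x) (at (inverse x))"
      using x' by (intro Li2_int_has_field_derivative) auto
    from DERIV_chain2[OF this DERIV_inverse[OF x'(4)]]
    have "((\<lambda>x. Li2_int (inverse x)) has_field_derivative Ln (1 - inverse x) / x) (at x)"
      using x' by (simp add: field_simps power2_eq_square)
    moreover have "((\<lambda>x. (Ln (- x))\<^sup>2 / 2) has_field_derivative Ln (- x) / x) (at x)"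
      using x' by (auto intro!: derivative_eq_intros simp: field_simps)
    ultimately have "(?D has_field_derivative
        (- Ln (1 - x) / x + Ln (1 - inverse x) / x + Ln (- x) / x)) (at x)"
      using x' by (intro DERIV_add Li2_int_has_field_derivative)
    then show ?thesis
      by (simp add: Ln_one_minus_inverse[OF x] add_divide_distrib diff_divide_distrib)
  qed
  have "connected ?S" "open ?S"
    using starlike_imp_connected starlike_slotted_complex_plane_right closed_slot_right
    by (auto simp: open_Compl)
  moreover have "continuous_on ?S ?D"
    using D by (meson DERIV_continuous_on has_field_derivative_at_within)
  ultimately obtain c where c: "\<And>x. x \<in> ?S \<Longrightarrow> ?D x = c"
    using DERIV_zero_connected_constant[of ?S "{}" ?D] D by auto
  have "c = - (of_real pi)\<^sup>2 / 6"
    using c[of "-1"] by (simp add: slotted_iff Li2_int_minus_one del: Compl_iff)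
  with c[OF assms] show ?thesis
    by (simp add: algebra_simps)
qed

text \<open>The inversion formula holds in the lower half plane, and each term on its right-hand
  side has a limit at \<open>x\<close>; \<open>inverse x\<close> lies in the unit disc.\<close>

lemma Li2_int_tendsto_lower:
  assumes x: "x > 1"
  shows "(Li2_int \<longlongrightarrow>
      - (of_real pi)\<^sup>2 / 6 - (Ln (- of_real x))\<^sup>2 / 2 - Li2_int (inverse (of_real x)))
      (at (of_real x) within {w. Im w < 0})"
proof (rule Lim_transform_eventually)
  let ?F = "at (complex_of_real x) within {w. Im w < 0}"
  have "((\<lambda>w. Ln w + \<i> * pi) \<longlongrightarrow> Ln (of_real x) + \<i> * pi) ?F"
    using x by (intro tendsto_intros) auto
  moreover have "Ln (- of_real x) = Ln (of_real x) + \<i> * pi"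
    using x by (subst Ln_minus) auto
  ultimately have "((\<lambda>w. Ln w + \<i> * pi) \<longlongrightarrow> Ln (- of_real x)) ?F"
    by simp
  \<comment> \<open>\<open>Ln\<close> jumps at \<open>- x\<close>, but for \<open>Im w < 0\<close>
    the value \<open>Ln (- w)\<close> agrees with \<open>Ln w + \<i> * pi\<close>, which is
    continuous at \<open>x\<close>.\<close>
  moreover have "eventually (\<lambda>w. Ln w + \<i> * pi = Ln (- w)) ?F"
    unfolding eventually_at_filter by (intro always_eventually allI impI, subst Ln_minus) auto
  ultimately have "((\<lambda>w. Ln (- w)) \<longlongrightarrow> Ln (- of_real x)) ?F"
    by (rule Lim_transform_eventually)
  moreover have "((\<lambda>w. Li2_int (inverse w)) \<longlongrightarrow> Li2_int (inverse (of_real x))) ?F"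
    using x by (intro isCont_tendsto_compose[OF isCont_Li2_int] tendsto_intros unit_disc_slit_plane)
      (auto simp: norm_inverse inverse_less_1_iff)
  ultimately show "((\<lambda>w. - (of_real pi)\<^sup>2 / 6 - (Ln (- w))\<^sup>2 / 2 - Li2_int (inverse w)) \<longlongrightarrow>
      - (of_real pi)\<^sup>2 / 6 - (Ln (- of_real x))\<^sup>2 / 2 - Li2_int (inverse (of_real x))) ?F"
    by (intro tendsto_diff tendsto_divide tendsto_power tendsto_const) auto
  show "eventually (\<lambda>w. - (of_real pi)\<^sup>2 / 6 - (Ln (- w))\<^sup>2 / 2 - Li2_int (inverse w) = Li2_int w) ?F"
    unfolding eventually_at_filter
    by (intro always_eventually allI impI, subst (2) Li2_int_inversion, subst slotted_iff) auto
qed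

text \<open>
  On the cut, too: the principal value \<open>Ln (- x) = ln x + \<i> \<pi>\<close> is the limit of \<open>Ln (- z)\<close> as
  \<open>z\<close> approaches \<open>x > 1\<close> from the lower half plane, the side from which \<open>Li2\<close> is defined there.
\<close>

lemma Li2_inversion:
  assumes z: "norm z > 1"
  shows "Li2 z = - (of_real pi)\<^sup>2 / 6 - (Ln (- z))\<^sup>2 / 2 - Li2_series (inverse z)"
proof -
  have iz: "Li2_int (inverse z) = Li2_series (inverse z)"
    using z by (intro Li2_int_eq_series) (simp add: norm_inverse inverse_less_1_iff)
  show ?thesis
  proof (cases "z \<in> complex_of_real ` {1..}")
    case True
    then obtain x where x: "z = of_real x" "x > 1"
      using z by auto
    \<comment> \<open>\<open>Lim\<close> is determined by convergence only along a nontrivial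
      filter, so \<open>x\<close> must be a limit point of the lower half plane.\<close>
    have "\<not> trivial_limit (at (complex_of_real x) within {w. Im w < 0})"
    proof -
      have "complex_of_real x islimpt {w. Im w < 0}"
        unfolding islimpt_approachable
      proof (intro allI impI)
        fix e :: real
        assume "0 < e"
        then show "\<exists>x'\<in>{w. Im w < 0}. x' \<noteq> complex_of_real x \<and> dist x' (complex_of_real x) < e"
          by (intro bexI[of _ "Complex x (- e / 2)"])
             (auto simp: complex_eq_iff dist_norm cmod_def)
      qed
      then show ?thesis
        by (simp add: trivial_limit_within)
    qed
    from tendsto_Lim[OF this Li2_int_tendsto_lower[OF x(2)]] True z iz x(1)
    show ?thesis
      by (simp add: Li2_def)
  next
    case False
    have "z \<in> - (complex_of_real ` {0..})"
    proof (clarsimp)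
      fix r :: real
      assume "z = of_real r" "0 \<le> r"
      with z False show False by auto
    qed
    with z False iz show ?thesis
      by (simp add: Li2_def Li2_int_inversion)
  qed
qed

subsection \<open>Zeros and Newton's method\<close>

text \<open>Taylor's formula at \<open>z\<close>, evaluated at the zero, gives |f z + g z (\<rho> -
  z)| \<le> m |z - \<rho>|^2. Dividing by |g z| \<ge> m shows that a step at least squares the
  distance to \<rho>, so a start at distance below 1 never leaves the ball.\<close>

lemma newton_locally_converges:
  fixes f g h :: "complex \<Rightarrow> complex"
  assumes f: "\<And>z. z \<in> ball \<rho> 1 \<Longrightarrow> (f has_field_derivative g z) (at z)"
    and g: "\<And>z. z \<in> ball \<rho> 1 \<Longrightarrow> (g has_field_derivative h z) (at z)"
    and h: "\<And>z. z \<in> ball \<rho> 1 \<Longrightarrow> norm (h z) \<le> m"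
    and m: "\<And>z. z \<in> ball \<rho> 1 \<Longrightarrow> m \<le> norm (g z)" "0 < m"
    and \<rho>: "f \<rho> = 0" and c: "norm (c - \<rho>) < 1"
  shows "newton_well_defined f c \<and> converges_quadratically (newton_seq f c) \<rho>"
proof -
  have step: "norm (z - f z / deriv f z - \<rho>) \<le> norm (z - \<rho>) ^ 2" if z: "z \<in> ball \<rho> 1" for z
  proof -
    have nz: "g z \<noteq> 0"
      using m(1)[OF z] m(2) by auto
    let ?F = "\<lambda>i::nat. if i = 0 then f else if i = 1 then g else h"
    \<comment> \<open>The complex Taylor estimate carries \<open>fact 1\<close> in the remainder,
      not \<open>fact 2\<close>.\<close>
    have "norm (?F 0 \<rho> - (\<Sum>i\<le>1. ?F i z * (\<rho> - z) ^ i / fact i)) \<le> m * norm (\<rho> - z) ^ Suc 1 / fact 1"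
    proof (rule complex_Taylor[of "ball \<rho> 1"])
      fix i :: nat and x
      assume "x \<in> ball \<rho> 1" "i \<le> 1"
      then show "(?F i has_field_derivative ?F (Suc i) x) (at x within ball \<rho> 1)"
        using f g by (cases i) (auto intro: has_field_derivative_at_within)
    qed (use z h in auto)
    then have "norm (f z + g z * (\<rho> - z)) \<le> m * norm (z - \<rho>) ^ 2"
      using \<rho> by (simp add: norm_minus_commute power2_eq_square norm_minus_cancel[of "_ + _", symmetric] del: norm_minus_cancel)
    also have "\<dots> \<le> norm (g z) * norm (z - \<rho>) ^ 2"
      using m(1)[OF z] by (intro mult_right_mono) auto
    finally have "norm (f z + g z * (\<rho> - z)) / norm (g z) \<le> norm (z - \<rho>) ^ 2"
      using nz by (simp add: divide_simps mult.commute)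
    moreover have "z - f z / g z - \<rho> = - ((f z + g z * (\<rho> - z)) / g z)"
      using nz by (simp add: field_simps)
    ultimately show ?thesis
      using DERIV_imp_deriv[OF f[OF z]] by (simp add: norm_divide)
  qed
  define \<delta> where "\<delta> = norm (c - \<rho>)"
  have \<delta>: "0 \<le> \<delta>" "\<delta> < 1"
    using c by (auto simp: \<delta>_def)
  have in_ball: "z \<in> ball \<rho> 1" if "norm (z - \<rho>) \<le> \<delta> ^ Suc n" for z n
  proof -
    have "\<delta> ^ Suc n \<le> \<delta>"
      using \<delta> power_decreasing[of 1 "Suc n" \<delta>] by simp
    with that \<delta> show ?thesis
      by (simp add: dist_norm norm_minus_commute)
  qed
  \<comment> \<open>Weaker than the rate \<open>\<delta> ^ (2 ^ n)\<close>, but enough to keep the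
    iterates in the ball and to make the error tend to 0.\<close>
  have bound: "norm (newton_seq f c n - \<rho>) \<le> \<delta> ^ Suc n" for n
  proof (induction n)
    case (Suc n)
    have "norm (newton_seq f c (Suc n) - \<rho>) \<le> norm (newton_seq f c n - \<rho>) ^ 2"
      using step[OF in_ball[OF Suc]] by simp
    also have "\<dots> \<le> (\<delta> ^ Suc n) ^ 2"
      using Suc by (intro power_mono) auto
    also have "\<dots> = \<delta> ^ (Suc n * 2)"
      by (rule power_mult[symmetric])
    also have "\<dots> \<le> \<delta> ^ Suc (Suc n)"
      using \<delta> by (intro power_decreasing) auto
    finally show ?case .
  qed (simp add: \<delta>_def)
  note iterates_in_ball = in_ball[OF bound]
  have "newton_well_defined f c"
    unfolding newton_well_defined_def
  proof (intro allI conjI)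
    fix n
    show "f field_differentiable at (newton_seq f c n)"
      using f[OF iterates_in_ball] field_differentiable_def by blast
    show "deriv f (newton_seq f c n) \<noteq> 0"
      using m(1)[OF iterates_in_ball[of n]] m(2) DERIV_imp_deriv[OF f[OF iterates_in_ball[of n]]] by auto
  qed
  moreover have "(\<lambda>n. newton_seq f c n - \<rho>) \<longlonglongrightarrow> 0"
  proof (rule Lim_null_comparison)
    show "\<forall>\<^sub>F n in sequentially. norm (newton_seq f c n - \<rho>) \<le> \<delta> ^ Suc n"
      using bound by simp
    show "(\<lambda>n. \<delta> ^ Suc n) \<longlonglongrightarrow> 0"
      using \<delta> by (intro LIMSEQ_Suc LIMSEQ_power_zero) simp
  qed
  then have "newton_seq f c \<longlonglongrightarrow> \<rho>"
    by (simp add: LIM_zero_iff)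
  moreover have "norm (newton_seq f c (Suc n) - \<rho>) \<le> 1 * norm (newton_seq f c n - \<rho>) ^ 2" for n
    using step[OF iterates_in_ball[of n]] by simp
  ultimately show ?thesis
    unfolding converges_quadratically_def by blast
qed

text \<open>In this open region, off the disc and the cut, \<open>Li2\<close> is
  \<open>Li2_int\<close> by definition. The unit ball about each zero will turn out to lie in
  it.\<close>

lemma phi0_has_field_derivative:
  assumes "norm z > 1" "Re z < 0"
  shows "(phi0 A has_field_derivative - Ln (1 - z) / z) (at z)"
proof -
  let ?U = "{z. norm z > 1} \<inter> {z. Re z < 0}"
  have U: "open ?U" "z \<in> ?U"
    using assms by (auto intro!: open_Int open_halfspace_Re_lt open_Collect_less continuous_intros)
  have D: "(Li2_int has_field_derivative - Ln (1 - z) / z) (at z)"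
    using assms by (intro Li2_int_has_field_derivative) (auto simp: slit_plane_iff)
  have "((\<lambda>z. Li2_int z + 4 * of_real pi ^ 2 * of_int A) has_field_derivative - Ln (1 - z) / z) (at z)"
    using DERIV_add[OF D DERIV_const[of "4 * of_real pi ^ 2 * of_int A"]] by simp
  then show ?thesis
    by (rule has_field_derivative_transform_within_open[OF _ U]) (auto simp: phi0_def Li2_def)
qed

section \<open>Location of the zeros\<close>

definition sqrt_term :: "int \<Rightarrow> real" where
  "sqrt_term A = pi * sqrt (8 * of_int A - 1 / 3)"

lemma rho_approx_eq: "rho_approx A = - exp (of_real (sqrt_term A))"
  by (simp only: rho_approx_def sqrt_term_def exp_of_real)

text \<open>The first bound, from (11/4)^2 = 121/16 < 23/3, serves the absolute estimates; the
  second gives the order 1/sqrt A.\<close>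

lemma sqrt_term_ge:
  assumes "A \<ge> 1"
  shows "sqrt_term A \<ge> 11 / 4 * pi" "sqrt_term A \<ge> pi * sqrt (of_int A)" "sqrt_term A > 0"
proof -
  have A: "(1::real) \<le> of_int A"
    using assms by simp
  then have "11 / 4 \<le> sqrt (8 * of_int A - 1 / 3)"
    by (intro real_le_rsqrt) (simp add: power2_eq_square)
  then show ge: "sqrt_term A \<ge> 11 / 4 * pi"
    by (simp add: sqrt_term_def mult.commute)
  with pi_gt_zero show "sqrt_term A > 0" by linarith
  show "sqrt_term A \<ge> pi * sqrt (of_int A)"
    using A by (simp add: sqrt_term_def)
qed

text \<open>On the closed unit disc |Li2| is at most pi^2/6, while a zero requires the value -4 pi^2
  A.\<close>

lemma phi0_zero_norm_gt_1:
  assumes "A \<ge> 1" "phi0 A \<rho> = 0"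
  shows "norm \<rho> > 1"
proof (rule ccontr)
  assume "\<not> norm \<rho> > 1"
  then have le: "norm \<rho> \<le> 1" by simp
  have "norm \<rho> * (pi\<^sup>2 / 6) \<le> 1 * (pi\<^sup>2 / 6)"
    using le by (intro mult_right_mono) auto
  with norm_Li2_series_le[OF le] have "norm (Li2_series \<rho>) \<le> pi\<^sup>2 / 6"
    by linarith
  moreover have "Li2 \<rho> = Li2_series \<rho>"
    using le by (simp add: Li2_def Li2_series_def)
  ultimately have "norm (Li2 \<rho>) \<le> pi\<^sup>2 / 6"
    by simp
  moreover have "Li2 \<rho> = - of_real (4 * pi\<^sup>2 * of_int A)"
    using assms(2) by (simp add: phi0_def eq_neg_iff_add_eq_0)
  then have "norm (Li2 \<rho>) = 4 * pi\<^sup>2 * of_int A"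
    using assms(1) by (simp only: norm_minus_cancel norm_of_real) simp
  moreover have "4 * pi\<^sup>2 * 1 \<le> 4 * pi\<^sup>2 * of_int A"
    using assms(1) by (intro mult_left_mono) auto
  moreover have "pi\<^sup>2 > 0" by simp
  ultimately show False by linarith
qed

lemma phi0_zero_bounds:
  assumes A: "A \<ge> 1" and \<rho>: "phi0 A \<rho> = 0"
  shows "norm \<rho> \<ge> 128" "norm (\<rho> - rho_approx A) \<le> pi\<^sup>2 / (2 * sqrt_term A)"
proof -
  define w where "w = Ln (- \<rho>)"
  define s where "s = sqrt_term A"
  have gt1: "norm \<rho> > 1"
    by (rule phi0_zero_norm_gt_1[OF A \<rho>])
  then have nz: "\<rho> \<noteq> 0" by auto
  have expw: "exp w = - \<rho>"
    using nz by (simp add: w_def)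
  then have norm_eq: "norm \<rho> = exp (Re w)"
    by (metis norm_exp_eq_Re norm_minus_cancel)
  with gt1 have Re_w: "Re w > 0" by simp
  have s_ge: "s \<ge> 11 / 4 * pi"
    using sqrt_term_ge[OF A] by (simp add: s_def)
  with pi_gt3 have s8: "s \<ge> 8" by linarith
  have pi_sq: "pi\<^sup>2 \<le> 16"
    using pi_less_4 pi_gt3 power_mono[of pi 4 2] by simp
  \<comment> \<open>The choice of \<open>s\<close> gives s^2/2 = 4 pi^2 A - pi^2/6, which absorbs
    the constant of the inversion formula.\<close>
  have "s\<^sup>2 = pi\<^sup>2 * (8 * of_int A - 1 / 3)"
    using A by (simp add: s_def sqrt_term_def power_mult_distrib)
  then have "complex_of_real (s\<^sup>2) = of_real (pi\<^sup>2 * (8 * of_int A - 1 / 3))"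
    by (simp only:)
  then have s_sq: "(of_real s)\<^sup>2 = (of_real pi)\<^sup>2 * (8 * of_int A - 1 / 3 :: complex)"
    by simp
  have "(of_real s)\<^sup>2 - w\<^sup>2 - 2 * Li2_series (inverse \<rho>) = 2 * phi0 A \<rho>"
    unfolding phi0_def Li2_inversion[OF gt1] w_def s_sq by (simp add: field_simps)
  then have "(w - s) * (w + s) = - 2 * Li2_series (inverse \<rho>)"
    using \<rho> by (simp add: algebra_simps power2_eq_square)
  then have "norm (w - s) * norm (w + s) = 2 * norm (Li2_series (inverse \<rho>))"
    by (metis mult_minus_left norm_minus_cancel norm_mult norm_numeral)
  also have "\<dots> \<le> 2 * (norm (inverse \<rho>) * (pi\<^sup>2 / 6))"
    using gt1 by (intro mult_left_mono norm_Li2_series_le) (auto simp: norm_inverse inverse_le_1_iff)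
  also have "\<dots> = pi\<^sup>2 / 3 / norm \<rho>"
    unfolding norm_inverse by (simp add: field_simps)
  finally have prod: "norm (w - s) * norm (w + s) \<le> pi\<^sup>2 / 3 / norm \<rho>" .
  \<comment> \<open>\<open>Re w > 0\<close> keeps \<open>w\<close> away from the other root
    \<open>- s\<close>.\<close>
  have "s \<le> norm (w + s)"
    using complex_Re_le_cmod[of "w + s"] Re_w by simp
  then have "norm (w - s) * s \<le> norm (w - s) * norm (w + s)"
    by (intro mult_left_mono) auto
  with prod have ds: "norm (w - s) * s \<le> pi\<^sup>2 / 3 / norm \<rho>" by linarith
  then have "norm (w - s) * s * norm \<rho> \<le> pi\<^sup>2 / 3"
    using gt1 by (subst (asm) pos_le_divide_eq) linarith+
  then have d: "norm (w - s) * norm \<rho> \<le> pi\<^sup>2 / (3 * s)"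
    using s8 by (simp add: field_simps)
  have "pi\<^sup>2 / (3 * s) \<le> 16 / (3 * 8)"
    using pi_sq s8 by (intro frac_le) auto
  with d have d': "norm (w - s) * norm \<rho> \<le> 2 / 3" by simp
  \<comment> \<open>Bootstrap: the crude bound from |\<rho>| > 1 yields Re w \<ge> 7, hence |\<rho>|
    = exp (Re w) \<ge> 2^7 = 128, which in turn sharpens the bound on |w - s|.\<close>
  moreover have "norm (w - s) * 1 \<le> norm (w - s) * norm \<rho>"
    using gt1 by (intro mult_left_mono) auto
  ultimately have "norm (w - s) \<le> 2 / 3" by linarith
  with abs_Re_le_cmod[of "w - s"] s8 have "Re w \<ge> 7" by simp
  then have "exp (Re w) \<ge> exp 7" by simp
  moreover have "exp 7 = exp (1 :: real) ^ 7"
    by (simp flip: exp_of_nat_mult)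
  moreover have "exp (1 :: real) ^ 7 \<ge> 2 ^ 7"
    using exp_ge_add_one_self[of 1] by (intro power_mono) auto
  ultimately show big: "norm \<rho> \<ge> 128"
    using norm_eq by simp
  have "norm (w - s) * 128 \<le> norm (w - s) * norm \<rho>"
    using big by (intro mult_left_mono) auto
  with d' have small: "norm (s - w) \<le> 1 / 2"
    by (simp add: norm_minus_commute)
  \<comment> \<open>The factor |exp w| = |\<rho>| is cancelled by the 1/|\<rho>| in the bound on |w
    - s|.\<close>
  have "exp w * (exp (s - w) - 1) = \<rho> - rho_approx A"
    by (simp add: algebra_simps flip: exp_add) (simp add: expw rho_approx_eq s_def)
  then have "norm (\<rho> - rho_approx A) = norm \<rho> * norm (exp (s - w) - 1)"
    by (metis expw norm_minus_cancel norm_mult)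
  also have "\<dots> \<le> norm \<rho> * (3 / 2 * norm (s - w))"
    using small by (intro mult_left_mono norm_exp_bounds) auto
  also have "\<dots> = 3 / 2 * (norm (w - s) * norm \<rho>)"
    by (simp add: norm_minus_commute)
  also have "\<dots> \<le> 3 / 2 * (pi\<^sup>2 / (3 * s))"
    using d by (intro mult_left_mono) auto
  finally show "norm (\<rho> - rho_approx A) \<le> pi\<^sup>2 / (2 * sqrt_term A)"
    by (simp add: s_def)
qed

text \<open>This puts the start into the ball on which \<open>newton_locally_converges\<close>
  works; the constant 11/4 makes the error at most 2 pi/11.\<close>

lemma phi0_zero_error_lt_1:
  assumes A: "A \<ge> 1" and \<rho>: "phi0 A \<rho> = 0"
  shows "norm (rho_approx A - \<rho>) < 1"
proof -
  have "pi\<^sup>2 / (2 * sqrt_term A) \<le> pi\<^sup>2 / (2 * (11 / 4 * pi))"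
    using sqrt_term_ge[OF A] by (intro divide_left_mono mult_pos_pos) auto
  also have "\<dots> = 2 / 11 * pi"
    by (simp add: power2_eq_square)
  also have "\<dots> < 1"
    using pi_less_4 by simp
  finally show ?thesis
    using phi0_zero_bounds(2)[OF A \<rho>] by (simp add: norm_minus_commute)
qed

lemma phi0_zero_error_le:
  assumes A: "A \<ge> 1" and \<rho>: "phi0 A \<rho> = 0"
  shows "norm (\<rho> - rho_approx A) \<le> 2 * (1 / sqrt (of_int A))"
proof -
  have A0: "0 < sqrt (real_of_int A)"
    using A by simp
  have "pi\<^sup>2 / (2 * sqrt_term A) \<le> pi\<^sup>2 / (2 * (pi * sqrt (of_int A)))"
    using sqrt_term_ge[OF A] A0 by (intro divide_left_mono mult_pos_pos) auto
  also have "\<dots> = pi / 2 * (1 / sqrt (of_int A))"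
    by (simp add: power2_eq_square)
  also have "\<dots> \<le> 2 * (1 / sqrt (of_int A))"
    using pi_less_4 A0 by (intro mult_right_mono) auto
  finally show ?thesis
    using phi0_zero_bounds(2)[OF A \<rho>] by linarith
qed

section \<open>Newton's method at the zeros\<close>

lemma norm_Ln_bounds:
  assumes "norm z \<ge> 127"
  shows "4 \<le> norm (Ln (1 - z))" "norm (Ln (1 - z)) \<le> norm z + 4"
proof -
  have n: "norm (1 - z) \<ge> norm z - 1" "norm (1 - z) \<le> 1 + norm z"
    using norm_triangle_ineq2[of z 1] norm_triangle_ineq4[of 1 z] by (auto simp: norm_minus_commute)
  then have pos: "norm (1 - z) > 0" using assms by linarith
  then have nz: "1 - z \<noteq> 0" by simp
  have Re: "Re (Ln (1 - z)) = ln (norm (1 - z))"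
    using nz by (rule Re_Ln)
  have "exp (4::real) = exp 1 ^ 4"
    by (simp flip: exp_of_nat_mult)
  also have "\<dots> \<le> 3 ^ 4"
    using exp_le by (intro power_mono) auto
  \<comment> \<open>3^4 = 81 lies below 127 - 1.\<close>
  finally have "exp 4 \<le> norm (1 - z)"
    using n assms by simp
  then have ln4: "4 \<le> ln (norm (1 - z))"
    using pos by (simp add: ln_ge_iff)
  with Re show "4 \<le> norm (Ln (1 - z))"
    using complex_Re_le_cmod[of "Ln (1 - z)"] by simp
  \<comment> \<open>A linear bound suffices, as it will be divided by |z|^2.\<close>
  have "ln (norm (1 - z)) \<le> norm z"
    using ln_le_minus_one[OF pos] n by linarith
  moreover have "\<bar>Im (Ln (1 - z))\<bar> \<le> 4"
    using mpi_less_Im_Ln[OF nz] Im_Ln_le_pi[OF nz] pi_less_4 by linarith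
  ultimately show "norm (Ln (1 - z)) \<le> norm z + 4"
    using cmod_le[of "Ln (1 - z)"] Re ln4 by linarith
qed

text \<open>The constant \<open>m\<close> separates the two derivatives on the unit ball about
  \<rho>: there |g z| \<ge> 4/|z| and |h z| \<le> 2/|z|, with |z| within 1 of the large number
  |\<rho>|.\<close>

lemma newton_phi0:
  assumes A: "A \<ge> 1" and \<rho>: "phi0 A \<rho> = 0"
  shows "newton_well_defined (phi0 A) (rho_approx A) \<and>
    converges_quadratically (newton_seq (phi0 A) (rho_approx A)) \<rho>"
proof (rule newton_locally_converges[where m = "4 / (norm \<rho> + 1)"
      and g = "\<lambda>z. - Ln (1 - z) / z" and h = "\<lambda>z. 1 / (z * (1 - z)) + Ln (1 - z) / z\<^sup>2"])
  note big = phi0_zero_bounds(1)[OF A \<rho>]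
  note close = phi0_zero_error_lt_1[OF A \<rho>]
  show "0 < 4 / (norm \<rho> + 1)"
    using big by simp
  fix z
  assume "z \<in> ball \<rho> 1"
  then have z: "norm (z - \<rho>) < 1"
    by (simp add: dist_norm norm_minus_commute)
  have n: "norm z \<ge> norm \<rho> - 1" "norm z \<le> norm \<rho> + 1"
    using norm_triangle_ineq2[of \<rho> z] norm_triangle_ineq2[of z \<rho>] z
    by (auto simp: norm_minus_commute)
  with big have n127: "norm z \<ge> 127" by linarith
  \<comment> \<open>The start is real and at most -2, and \<open>z\<close> is at distance less than
    2 from it, so \<open>z\<close> lies in the left half plane, away from the cut.\<close>
  have "Re (z - rho_approx A) \<le> norm (z - \<rho>) + norm (rho_approx A - \<rho>)"
    using complex_Re_le_cmod[of "z - rho_approx A"] norm_triangle_ineq4[of "z - \<rho>" "rho_approx A - \<rho>"]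
    by simp
  moreover have "sqrt_term A \<ge> 1"
    using sqrt_term_ge(1)[OF A] pi_gt3 by linarith
  then have "exp (sqrt_term A) \<ge> 2"
    using exp_ge_add_one_self[of "sqrt_term A"] by linarith
  then have "Re (rho_approx A) \<le> - 2"
    by (simp add: rho_approx_def flip: sqrt_term_def)
  ultimately have Re_z: "Re z < 0"
    using z close by simp
  show "(phi0 A has_field_derivative - Ln (1 - z) / z) (at z)"
    using n127 Re_z by (intro phi0_has_field_derivative) auto
  have nz: "z \<noteq> 0" "1 - z \<noteq> 0" "1 - z \<notin> \<real>\<^sub>\<le>\<^sub>0"
    using Re_z by (auto simp: complex_nonpos_Reals_iff)
  show "((\<lambda>z. - Ln (1 - z) / z) has_field_derivative 1 / (z * (1 - z)) + Ln (1 - z) / z\<^sup>2) (at z)"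
    using nz by (auto intro!: derivative_eq_intros simp: field_simps power2_eq_square)
  note Ln = norm_Ln_bounds[OF n127]
  have "4 / (norm \<rho> + 1) \<le> 4 / norm z"
    using n n127 by (intro divide_left_mono mult_pos_pos) linarith+
  also have "\<dots> \<le> norm (Ln (1 - z)) / norm z"
    using Ln by (intro divide_right_mono) auto
  finally show "4 / (norm \<rho> + 1) \<le> norm (- Ln (1 - z) / z)"
    by (simp add: norm_divide)
  have "norm (1 - z) \<ge> norm z - 1"
    using norm_triangle_ineq2[of z 1] by (simp add: norm_minus_commute)
  then have "norm (1 - z) \<ge> 2"
    using n127 by linarith
  then have "norm (1 / (z * (1 - z))) \<le> 1 / (norm z * 2)"
    using n127 by (simp add: norm_divide norm_mult divide_simps)
  moreover have "norm (Ln (1 - z) / z\<^sup>2) \<le> (norm z + 4) / (norm z)\<^sup>2"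
    using Ln by (simp add: norm_divide norm_power divide_right_mono)
  moreover have "(norm z + 4) / (norm z)\<^sup>2 \<le> (3 / 2 * norm z) / (norm z)\<^sup>2"
    using n127 by (intro divide_right_mono) auto
  moreover have "1 / (norm z * 2) + (3 / 2 * norm z) / (norm z)\<^sup>2 = 2 / norm z"
    using nz by (simp add: field_simps power2_eq_square)
  moreover have "2 / norm z \<le> 2 / (norm \<rho> - 1)"
    using n big by (intro divide_left_mono mult_pos_pos) auto
  \<comment> \<open>For |\<rho>| > 1 this amounts to |\<rho>| \<ge> 3.\<close>
  moreover have "2 / (norm \<rho> - 1) \<le> 4 / (norm \<rho> + 1)"
    using big by (simp add: field_simps)
  ultimately show "norm (1 / (z * (1 - z)) + Ln (1 - z) / z\<^sup>2) \<le> 4 / (norm \<rho> + 1)"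
    by (intro norm_triangle_le) linarith
qed (use \<rho> phi0_zero_error_lt_1[OF A \<rho>] in auto)

theorem theorem1p2:
  shows "(\<exists>C. \<forall>A::int. \<forall>\<rho>::complex. A \<ge> 1 \<longrightarrow> phi0 A \<rho> = 0 \<longrightarrow>
            norm (\<rho> - rho_approx A) \<le> C * (1 / sqrt (of_int A))) \<and>
         (\<forall>A::int. \<forall>\<rho>::complex. A \<ge> 1 \<longrightarrow> phi0 A \<rho> = 0 \<longrightarrow>
            newton_well_defined (phi0 A) (rho_approx A) \<and>
            converges_quadratically (newton_seq (phi0 A) (rho_approx A)) \<rho>)"
  using phi0_zero_error_le newton_phi0 by blast

end
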